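(* Let $\mathcal{P}$ be any finite nonempty set of real prices, let $\ell\ge 1$ be any integer (the memory length), and let $g:\mathcal{P}^2\to\mathbb{R}$ be any reference-monotone gain function. Then there exists an $\ell$-up-1-down price cycle whose objective value $J$ is maximal among all price cycles, i.e. among all positive integers $c$ and all $(\pi_0,\ldots,\pi_{c-1})\in\mathcal{P}^c$.
   Context: A gain function $g:\mathcal{P}^2\to\mathbb{R}$, written $g(r,p)$ ($r$ = reference price, $p$ = offered price), is reference-monotone if for every fixed $p\in\mathcal{P}$, $g(r,p)$ is weakly increasing in $r\in\mathcal{P}$. A price cycle is a finite sequence $(\pi_0,\ldots,\pi_{c-1})\in\mathcal{P}^c$ with $c$ a positive integer (to be offered repeatedly forever). Its objective value (long-run average gain) is $$J(\pi_0,\ldots,\pi_{c-1})=\frac1c\sum_{t=0}^{c-1} g\Big(\min\{\pi_{(t-\ell)\bmod c},\ldots,\pi_{(t-1)\bmod c}\},\,\pi_t\Big),$$ where $c<\ell$ is allowed. Price cycles are represented by strings over the alphabet $\mathcal{P}$, with $p^k$ denoting the concatenation of $k$ copies of $p$; strings that differ by cyclic rotation or by repetition of the whole string represent the same cycle. A price cycle is $\ell$-up-1-down if it can be represented by a string $\rho_0^{k_0}\cdots\rho_{d-1}^{k_{d-1}}$, where $d\le|\mathcal{P}|$ is a positive integer, $\rho_0,\ldots,\rho_{d-1}$ are distinct prices in $\mathcal{P}$, and for all $t=0,\ldots,d-1$: $k_t=\ell$ if $\rho_t>\rho_{(t-1)\bmod d}$, and $k_t=1$ if $\rho_t<\rho_{(t-1)\bmod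 d}$. When $d=1$, we set $k_0=1$, so a constant price cycle is $\ell$-up-1-down. *)

theory Defs
  imports Complex_Main
begin

text \<open>The gain function is a total function on the reals; only its values on \<open>P \<times> P\<close> matter.
  The first argument is the reference price \<open>r\<close>, the second the offered price \<open>p\<close>.\<close>

definition reference_monotone :: "real set \<Rightarrow> (real \<Rightarrow> real \<Rightarrow> real) \<Rightarrow> bool" where
  "reference_monotone P g \<longleftrightarrow> (\<forall>p\<in>P. mono_on P (\<lambda>r. g r p))"

definition price_cycles :: "real set \<Rightarrow> real list set" where
  "price_cycles P = {\<pi>. \<pi> \<noteq> [] \<and> set \<pi> \<subseteq> P}"

text \<open>Integer indices, since offsets such as \<open>t - j\<close> may be negative; \<open>mod\<close> on the
  integers yields a representative in \<open>{0..<length xs}\<close>.\<close>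

definition cyclic_nth :: "'a list \<Rightarrow> int \<Rightarrow> 'a" where
  "cyclic_nth xs i = xs ! nat (i mod int (length xs))"

definition reference_price :: "nat \<Rightarrow> real list \<Rightarrow> nat \<Rightarrow> real" where
  "reference_price l \<pi> t = Min ((\<lambda>j. cyclic_nth \<pi> (int t - int j)) ` {1..l})"

definition average_gain :: "nat \<Rightarrow> (real \<Rightarrow> real \<Rightarrow> real) \<Rightarrow> real list \<Rightarrow> real" where
  "average_gain l g \<pi> =
     1 / real (length \<pi>) * (\<Sum>t<length \<pi>. g (reference_price l \<pi> t) (\<pi> ! t))"

text \<open>Two strings represent the same cycle if they are related by the equivalence relation
  generated by cyclic rotation and by repetition of the whole string.\<close>

definition same_cycle :: "'a list \<Rightarrow> 'a list \<Rightarrow> bool" where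
  "same_cycle = equivclp (\<lambda>xs ys. (\<exists>n. ys = rotate n xs) \<or> (\<exists>m\<ge>1. ys = concat (replicate m xs)))"

definition power_string :: "'a list \<Rightarrow> nat list \<Rightarrow> 'a list" where
  "power_string \<rho> k = concat (map2 (\<lambda>r n. replicate n r) \<rho> k)"

text \<open>If \<open>d = length \<rho> > 1\<close>, the exponents are forced by distinctness of the prices; if \<open>d = 1\<close>,
  neither comparison applies and the exponent is fixed to be 1.\<close>

definition up_one_down :: "real set \<Rightarrow> nat \<Rightarrow> real list \<Rightarrow> bool" where
  "up_one_down P l \<pi> \<longleftrightarrow>
     (\<exists>\<rho> k. 0 < length \<rho> \<and> length \<rho> \<le> card P \<and> distinct \<rho> \<and> set \<rho> \<subseteq> P \<and>
        length k = length \<rho> \<and>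
        (\<forall>t<length \<rho>.
           (\<rho> ! t > cyclic_nth \<rho> (int t - 1) \<longrightarrow> k ! t = l) \<and>
           (\<rho> ! t < cyclic_nth \<rho> (int t - 1) \<longrightarrow> k ! t = 1)) \<and>
        (length \<rho> = 1 \<longrightarrow> k ! 0 = 1) \<and>
        same_cycle \<pi> (power_string \<rho> k))"

end

theory Submission
  imports Defs
begin

text \<open>A block \<open>p\<^sup>k\<close> offered at reference price \<open>r\<close> is an edge from \<open>r\<close> to \<open>p\<close> of duration \<open>l\<close> if \<open>p > r\<close>
  and \<open>1\<close> otherwise, and it earns its duration times \<open>g r p\<close>; \<open>l\<close>-up-1-down cycles are exactly the
  simple cycles of this graph on \<open>P\<close>. Let \<open>\<mu>\<close> be the largest ratio of gain to duration over simple cycles.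
  No cycle is positive for the edge weights \<open>duration * (g - \<mu>)\<close>, so longest paths give a
  potential \<open>h\<close>, which reference monotonicity makes increasing. For an arbitrary price sequence,
  averaging \<open>h\<close> over the minima of the last \<open>1, \<dots>, l\<close> prices yields a potential on price
  histories that decreases by at least \<open>g - \<mu>\<close> in each period; hence no cycle has average
  gain above \<open>\<mu>\<close>.\<close>

section \<open>Weighted walks and longest-path potentials\<close>

fun path_sum :: "('a \<Rightarrow> 'a \<Rightarrow> real) \<Rightarrow> 'a list \<Rightarrow> real" where
  "path_sum e (x # y # zs) = e x y + path_sum e (y # zs)"
| "path_sum e _ = 0"

lemma path_sum_append: "path_sum e (xs @ v # ys) = path_sum e (xs @ [v]) + path_sum e (v # ys)"
proof (induction xs)
  case (Cons x xs)
  then show ?case by (cases xs) auto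
qed simp

text \<open>A closed walk is encoded by repeating its first vertex at the end. Both sides split at
  \<open>m\<close> and at the head of \<open>a\<close> into the same two paths.\<close>

lemma path_sum_rotate:
  "path_sum e (m # b @ a @ [m]) = path_sum e ((a @ m # b) @ [hd (a @ m # b)])"
proof (cases a)
  case (Cons x a')
  then show ?thesis
    using path_sum_append[of e "m # b" x "a' @ [m]"] path_sum_append[of e "x # a'" m "b @ [x]"]
    by simp
qed simp

text \<open>This turns comparing a ratio of gain to duration with \<open>c\<close> into the sign of
  a single path weight.\<close>

lemma path_sum_weighted_diff:
  "path_sum (\<lambda>r p. w r p * (g r p - c)) xs = path_sum (\<lambda>r p. w r p * g r p) xs - c * path_sum w xs"
  by (induction w xs rule: path_sum.induct) (auto simp: algebra_simps)

lemma length_le_path_sum: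
  assumes "\<And>r p. w r p \<ge> 1"
  shows "real (length ys) \<le> path_sum w (r # ys)"
proof (induction ys arbitrary: r)
  case (Cons y ys)
  then show ?case using assms[of r y] by (simp add: add_mono)
qed simp

text \<open>Take for \<open>h r\<close> the largest weight of a simple path from \<open>r\<close>.
  Prepending an edge keeps the path simple or closes a cycle, and cutting that cycle off loses
  nothing.\<close>

lemma no_positive_cycle_potential:
  fixes e :: "'a \<Rightarrow> 'a \<Rightarrow> real"
  assumes "finite P"
    and cyc: "\<And>c. c \<noteq> [] \<Longrightarrow> distinct c \<Longrightarrow> set c \<subseteq> P \<Longrightarrow> path_sum e (c @ [hd c]) \<le> 0"
  obtains h where "\<And>r p. r \<in> P \<Longrightarrow> p \<in> P \<Longrightarrow> e r p + h p \<le> h r"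
    and "\<And>r r'. r \<in> P \<Longrightarrow> r' \<in> P \<Longrightarrow> (\<And>p. p \<in> P \<Longrightarrow> e r p \<le> e r' p) \<Longrightarrow> h r \<le> h r'"
proof -
  define S where "S r = {xs. set xs \<subseteq> P \<and> distinct xs \<and> xs \<noteq> [] \<and> hd xs = r}" for r
  define h where "h r = Max (path_sum e ` S r)" for r
  have finS: "finite (path_sum e ` S r)" for r
    by (rule finite_imageI, rule finite_subset[OF _ finite_subset_distinct[OF \<open>finite P\<close>]])
       (auto simp: S_def)
  have le_h: "path_sum e xs \<le> h r" if "xs \<in> S r" for xs r
    unfolding h_def using that finS by auto
  have single: "[r] \<in> S r" if "r \<in> P" for r
    using that by (simp add: S_def)
  have attained: "\<exists>zs. r # zs \<in> S r \<and> h r = path_sum e (r # zs)" if "r \<in> P" for r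
  proof -
    have "h r \<in> path_sum e ` S r"
      unfolding h_def using finS single[OF that] by (intro Max_in) auto
    then obtain xs where "xs \<in> S r" "h r = path_sum e xs" by auto
    then show ?thesis by (cases xs) (auto simp: S_def)
  qed
  have edge: "e r p + h p \<le> h r" if "r \<in> P" "p \<in> P" for r p
  proof -
    obtain zs where zs: "p # zs \<in> S p" "h p = path_sum e (p # zs)"
      using attained \<open>p \<in> P\<close> by blast
    show ?thesis
    proof (cases "r \<in> set (p # zs)")
      case False
      then have "r # p # zs \<in> S r" using zs(1) \<open>r \<in> P\<close> by (auto simp: S_def)
      then show ?thesis using le_h zs(2) by fastforce
    next
      case True
      then obtain as bs where split: "p # zs = as @ r # bs" by (meson split_list)
      with zs(1) have d: "distinct (as @ r # bs)" "set (as @ r # bs) \<subseteq> P"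
        by (simp_all add: S_def)
      have "e r p + h p = path_sum e (r # p # zs)" using zs(2) by simp
      also have "\<dots> = path_sum e ((r # as) @ r # bs)" using split by simp
      also have "\<dots> = path_sum e ((r # as) @ [r]) + path_sum e (r # bs)"
        by (rule path_sum_append)
      also have "path_sum e ((r # as) @ [r]) \<le> 0"
        using cyc[of "r # as"] d by auto
      also have "path_sum e (r # bs) \<le> h r"
        by (rule le_h) (use d in \<open>auto simp: S_def\<close>)
      finally show ?thesis by simp
    qed
  qed
  have mono: "h r \<le> h r'" if "r \<in> P" "r' \<in> P" "\<And>p. p \<in> P \<Longrightarrow> e r p \<le> e r' p" for r r'
  proof -
    obtain zs where zs: "r # zs \<in> S r" "h r = path_sum e (r # zs)"
      using attained \<open>r \<in> P\<close> by blast
    show ?thesis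
    proof (cases zs)
      case Nil
      then show ?thesis using le_h[OF single[OF \<open>r' \<in> P\<close>]] zs by simp
    next
      case (Cons p ps)
      then have p: "p \<in> P" "p # ps \<in> S p" using zs(1) by (auto simp: S_def)
      \<comment> \<open>Only the first edge of the optimal path is redirected to start at
        \<open>r'\<close>. Since \<open>r'\<close> may recur in \<open>ps\<close>, the edge
        inequality is used instead of the path \<open>r' # p # ps\<close>.\<close>
      have "h r = e r p + path_sum e (p # ps)" using zs Cons by simp
      also have "\<dots> \<le> e r' p + h p" using that(3)[OF p(1)] le_h[OF p(2)] by simp
      also have "\<dots> \<le> h r'" using edge \<open>r' \<in> P\<close> p by simp
      finally show ?thesis .
    qed
  qed
  show thesis using that edge mono by blast
qed

section \<open>Window minima and the upper bound on average gain\<close>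

lemma cyclic_nth_mem: "xs \<noteq> [] \<Longrightarrow> cyclic_nth xs i \<in> set xs"
  unfolding cyclic_nth_def by (intro nth_mem) (simp add: nat_less_iff)

lemma cyclic_nth_of_nat: "i < length xs \<Longrightarrow> cyclic_nth xs (int i) = xs ! i"
  by (simp add: cyclic_nth_def)

lemma reference_price_mem:
  assumes "\<pi> \<noteq> []" and "l \<ge> 1"
  shows "reference_price l \<pi> t \<in> set \<pi>"
proof -
  have "reference_price l \<pi> t \<in> (\<lambda>j. cyclic_nth \<pi> (int t - int j)) ` {1..l}"
    unfolding reference_price_def using assms(2) by (intro Min_in) auto
  then show ?thesis using cyclic_nth_mem[OF assms(1)] by auto
qed

lemma reference_price_antimono:
  "1 \<le> i \<Longrightarrow> i \<le> l \<Longrightarrow> reference_price l \<pi> t \<le> reference_price i \<pi> t"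
  unfolding reference_price_def by (intro Min_antimono image_mono) auto

lemma reference_price_length: "reference_price l \<pi> (length \<pi>) = reference_price l \<pi> 0"
proof -
  have "(int (length \<pi>) - j) mod int (length \<pi>) = (0 - j) mod int (length \<pi>)" for j
    by (metis mod_diff_left_eq mod_self mod_0)
  then show ?thesis by (simp add: reference_price_def cyclic_nth_def)
qed

lemma reference_price_1_Suc:
  "t < length \<pi> \<Longrightarrow> reference_price (Suc 0) \<pi> (Suc t) = \<pi> ! t"
  by (simp add: reference_price_def cyclic_nth_of_nat)

lemma reference_price_Suc_Suc:
  assumes "t < length \<pi>" and "i \<ge> 1"
  shows "reference_price (Suc i) \<pi> (Suc t) = min (\<pi> ! t) (reference_price i \<pi> t)"
proof -
  have "{1..Suc i} = insert 1 (Suc ` {1..i})"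
    by (auto simp: image_Suc_atLeastAtMost)
  then have "(\<lambda>j. cyclic_nth \<pi> (int (Suc t) - int j)) ` {1..Suc i}
      = insert (\<pi> ! t) ((\<lambda>j. cyclic_nth \<pi> (int t - int j)) ` {1..i})"
    using assms(1) by (simp add: image_image cyclic_nth_of_nat del: image_Suc_atLeastAtMost)
  then show ?thesis using assms(2) by (simp add: reference_price_def)
qed

text \<open>One period turns the window minima \<open>s_1, ..., s_l\<close> into
  \<open>p, min p s_1, ..., min p s_(l-1)\<close>. If \<open>s_l < p\<close>, replacing
  \<open>h s_l\<close> by \<open>h p\<close> pays for everything and the other terms do not grow.
  Otherwise all new minima equal \<open>p\<close>, and each of the \<open>l\<close> terms drops by
  at least \<open>h s_l - h p\<close>.\<close>

lemma history_potential_step: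
  assumes "l \<ge> 1" and "t < length \<pi>" and \<pi>: "\<pi> \<noteq> []" "set \<pi> \<subseteq> P"
    and h: "mono_on P h"
    and down: "\<And>r p. r \<in> P \<Longrightarrow> p \<in> P \<Longrightarrow> p \<le> r \<Longrightarrow> f r p \<le> h r - h p"
    and up: "\<And>r p. r \<in> P \<Longrightarrow> p \<in> P \<Longrightarrow> r < p \<Longrightarrow> real l * f r p \<le> h r - h p"
  shows "real l * f (reference_price l \<pi> t) (\<pi> ! t)
    \<le> (\<Sum>i<l. h (reference_price (Suc i) \<pi> t)) - (\<Sum>i<l. h (reference_price (Suc i) \<pi> (Suc t)))"
proof -
  define n where "n = l - 1"
  have l: "l = Suc n" using assms(1) by (simp add: n_def)
  define s p where "s = reference_price l \<pi> t" and "p = \<pi> ! t"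
  have ref: "reference_price (Suc i) \<pi> u \<in> P" for i u
    using reference_price_mem[OF \<pi>(1), of "Suc i" u] \<pi>(2) by auto
  have s: "s \<in> P" and p: "p \<in> P"
    using ref[of n t] assms(2) \<pi>(2) by (auto simp: s_def p_def l)
  have new: "(\<Sum>i<l. h (reference_price (Suc i) \<pi> (Suc t)))
      = h p + (\<Sum>i<n. h (min p (reference_price (Suc i) \<pi> t)))"
    unfolding l sum.lessThan_Suc_shift
    by (simp add: reference_price_1_Suc reference_price_Suc_Suc assms(2) p_def)
  have old: "(\<Sum>i<l. h (reference_price (Suc i) \<pi> t))
      = (\<Sum>i<n. h (reference_price (Suc i) \<pi> t)) + h s"
    by (simp add: l s_def)
  show ?thesis
  proof (cases "s < p")
    case True
    have "(\<Sum>i<n. h (min p (reference_price (Suc i) \<pi> t))) \<le> (\<Sum>i<n. h (reference_price (Suc i) \<pi> t))"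
      using p ref by (intro sum_mono mono_onD[OF h]) (auto simp: min_def)
    then show ?thesis
      using up[OF s p True] new old by (simp add: s_def p_def)
  next
    case False
    have ge: "s \<le> reference_price (Suc i) \<pi> t" if "i < n" for i
      unfolding s_def using that by (intro reference_price_antimono) (auto simp: l)
    then have "(\<Sum>i<n. h (min p (reference_price (Suc i) \<pi> t))) = (\<Sum>i<n. h p)"
      using False by (intro sum.cong refl) (force simp: min_def)
    moreover have "(\<Sum>i<n. h s) \<le> (\<Sum>i<n. h (reference_price (Suc i) \<pi> t))"
      using s ref ge by (intro sum_mono mono_onD[OF h]) auto
    moreover have "real l * f s p \<le> real l * (h s - h p)"
      using down[OF s p] False by (intro mult_left_mono) auto
    ultimately show ?thesis
      using new old by (simp add: s_def p_def l algebra_simps)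
  qed
qed

text \<open>Summed over one full cycle, the potential differences telescope to zero, because the
  windows at its end and at its start agree.\<close>

lemma average_gain_le:
  assumes "l \<ge> 1" and \<pi>: "\<pi> \<noteq> []" "set \<pi> \<subseteq> P" and "mono_on P h"
    and "\<And>r p. r \<in> P \<Longrightarrow> p \<in> P \<Longrightarrow> p \<le> r \<Longrightarrow> g r p - c \<le> h r - h p"
    and "\<And>r p. r \<in> P \<Longrightarrow> p \<in> P \<Longrightarrow> r < p \<Longrightarrow> real l * (g r p - c) \<le> h r - h p"
  shows "average_gain l g \<pi> \<le> c"
proof -
  define \<Phi> where "\<Phi> t = (\<Sum>i<l. h (reference_price (Suc i) \<pi> t))" for t
  have "real l * (\<Sum>t<length \<pi>. g (reference_price l \<pi> t) (\<pi> ! t) - c)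
      \<le> (\<Sum>t<length \<pi>. \<Phi> t - \<Phi> (Suc t))"
    unfolding sum_distrib_left \<Phi>_def using assms
    by (intro sum_mono history_potential_step[where f = "\<lambda>r p. g r p - c"]) auto
  also have "\<dots> = 0"
    by (subst sum_lessThan_telescope') (simp add: \<Phi>_def reference_price_length)
  finally have "(\<Sum>t<length \<pi>. g (reference_price l \<pi> t) (\<pi> ! t)) \<le> c * real (length \<pi>)"
    using assms(1) by (simp add: mult_le_0_iff sum_subtractf mult.commute)
  then show ?thesis
    using \<pi>(1) by (simp add: average_gain_def divide_le_eq)
qed

section \<open>Strings of blocks and their gain\<close>

definition hold_time :: "nat \<Rightarrow> real \<Rightarrow> real \<Rightarrow> nat" where
  "hold_time l r p = (if r < p then l else 1)"

text \<open>Here \<open>r\<close> is the price before the first block; the truncating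
  \<open>map2\<close> pairs each price with its predecessor.\<close>

definition hold_times :: "nat \<Rightarrow> real \<Rightarrow> real list \<Rightarrow> nat list" where
  "hold_times l r ys = map2 (hold_time l) (r # ys) ys"

lemma power_string_hold_times_Cons:
  "power_string (y # ys) (hold_times l r (y # ys)) =
     replicate (hold_time l r y) y @ power_string ys (hold_times l y ys)"
  by (simp add: power_string_def hold_times_def)

lemma power_string_hold_times_Nil: "power_string [] (hold_times l r []) = []"
  by (simp add: power_string_def hold_times_def)

lemma set_power_string_subset: "set (power_string ys k) \<subseteq> set ys"
  by (auto simp: power_string_def dest: set_zip_leftD)

text \<open>Durations count periods, so the ratio of gain to duration of a cycle is an average per
  period.\<close>

lemma length_power_string_hold_times:
  "real (length (power_string ys (hold_times l r ys))) = path_sum (\<lambda>r p. real (hold_time l r p)) (r # ys)"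
  by (induction ys arbitrary: r)
     (simp_all add: power_string_hold_times_Cons power_string_hold_times_Nil)

text \<open>While the blocks are played, the last \<open>l\<close> prices before each block are bounded below by the
  price of the preceding block.\<close>

lemma sum_gain_power_string_ge:
  assumes "l \<ge> 1" and mono: "reference_monotone P g"
    and "\<pi> = xs @ power_string ys (hold_times l r ys)" and "\<pi> \<noteq> []" and "set \<pi> \<subseteq> P"
    and "r \<in> P" and "set ys \<subseteq> P"
    and "\<And>j. 1 \<le> j \<Longrightarrow> j \<le> l \<Longrightarrow> r \<le> cyclic_nth \<pi> (int (length xs) - int j)"
  shows "path_sum (\<lambda>r p. real (hold_time l r p) * g r p) (r # ys)
    \<le> (\<Sum>t = length xs..<length \<pi>. g (reference_price l \<pi> t) (\<pi> ! t))"
  using assms(3-)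
\<comment> \<open>The whole string \<open>\<pi>\<close> stays fixed, since windows wrap around it;
  blocks already played move into \<open>xs\<close>.\<close>
proof (induction ys arbitrary: xs r)
  case Nil
  then show ?case by (simp add: power_string_hold_times_Nil)
next
  case (Cons y ys)
  define n where "n = hold_time l r y"
  define xs' where "xs' = xs @ replicate n y"
  have \<pi>: "\<pi> = xs' @ power_string ys (hold_times l y ys)"
    using Cons.prems(1) by (simp add: power_string_hold_times_Cons xs'_def n_def)
  have y: "y \<in> P" using Cons.prems by simp
  have n: "n = (if r < y then l else 1)" by (simp add: n_def hold_time_def)
  have len: "length xs' = length xs + n" "length xs' \<le> length \<pi>"
    by (simp_all add: xs'_def \<pi>)
  have nth: "\<pi> ! (length xs + i) = y" if "i < n" for i
    using that by (simp add: \<pi> xs'_def nth_append)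
  \<comment> \<open>The case \<open>i = n\<close> looks back from the position just after the
    block.\<close>
  have cnth: "cyclic_nth \<pi> (int (length xs + i) - int j) = y" if "i \<le> n" "j \<le> i" "1 \<le> j" for i j
  proof -
    have "int (length xs + i) - int j = int (length xs + (i - j))" using that by simp
    moreover have "length xs + (i - j) < length \<pi>" "i - j < n" using that len by linarith+
    ultimately show ?thesis using nth by (simp only: cyclic_nth_of_nat)
  qed
  have window: "r \<le> reference_price l \<pi> (length xs + i)" if i: "i < n" for i
    unfolding reference_price_def
  proof (rule Min.boundedI; clarsimp)
    fix j assume j: "Suc 0 \<le> j" "j \<le> l"
    show "r \<le> cyclic_nth \<pi> (int (length xs) + int i - int j)"
    proof (cases "j \<le> i")
      case True
      \<comment> \<open>A lookback of at least 1 that stays inside the block forces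
        \<open>n > 1\<close>, hence a price increase.\<close>
      then have "r < y" using i j n by (auto split: if_splits)
      then show ?thesis using cnth[of i j] True i j by simp
    next
      case False
      then have "int (length xs) + int i - int j = int (length xs) - int (j - i)" by simp
      moreover have "r \<le> cyclic_nth \<pi> (int (length xs) - int (j - i))"
        by (rule Cons.prems(6)) (use False j in auto)
      ultimately show ?thesis by (simp only:)
    qed
  qed (use \<open>l \<ge> 1\<close> in simp)
  have block: "real n * g r y \<le> (\<Sum>t = length xs..<length xs'. g (reference_price l \<pi> t) (\<pi> ! t))"
  proof -
    have "g r y \<le> g (reference_price l \<pi> t) (\<pi> ! t)" if "t \<in> {length xs..<length xs'}" for t
    proof -
      define i where "i = t - length xs"
      then have t: "t = length xs + i" "i < n" using that len by auto
      have "reference_price l \<pi> t \<in> P"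
        using reference_price_mem[OF \<open>\<pi> \<noteq> []\<close> \<open>l \<ge> 1\<close>, of t] \<open>set \<pi> \<subseteq> P\<close> by blast
      moreover have "mono_on P (\<lambda>r. g r y)" using mono y by (simp add: reference_monotone_def)
      ultimately have "g r y \<le> g (reference_price l \<pi> t) y"
        using mono_onD[of P "\<lambda>r. g r y"] Cons.prems(4) window t by blast
      then show ?thesis using nth t by simp
    qed
    then have "(\<Sum>t = length xs..<length xs'. g r y)
        \<le> (\<Sum>t = length xs..<length xs'. g (reference_price l \<pi> t) (\<pi> ! t))"
      by (intro sum_mono)
    then show ?thesis by (simp add: len)
  qed
  \<comment> \<open>The window condition passes to the next block: a block of length
    \<open>l\<close> fills the window with \<open>y\<close>, and otherwise all older prices in it
    are at least \<open>r \<ge> y\<close>.\<close>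
  have "y \<le> cyclic_nth \<pi> (int (length xs') - int j)" if "1 \<le> j" "j \<le> l" for j
  proof (cases "j \<le> n")
    case True
    then show ?thesis using cnth[of n j] that len by simp
  next
    case False
    then have n1: "n = 1" and "y \<le> r" using that n by (auto split: if_splits)
    moreover have "int (length xs') - int j = int (length xs) - int (j - 1)"
      using that len n1 by simp
    moreover have "r \<le> cyclic_nth \<pi> (int (length xs) - int (j - 1))"
      by (rule Cons.prems(6)) (use False that n1 in auto)
    ultimately show ?thesis by (simp only:)
  qed
  from Cons.IH[OF \<pi> Cons.prems(2,3) y _ this]
  have rest: "path_sum (\<lambda>r p. real (hold_time l r p) * g r p) (y # ys)
      \<le> (\<Sum>t = length xs'..<length \<pi>. g (reference_price l \<pi> t) (\<pi> ! t))"
    using Cons.prems(5) by simp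
  have "(\<Sum>t = length xs..<length xs'. g (reference_price l \<pi> t) (\<pi> ! t))
      + (\<Sum>t = length xs'..<length \<pi>. g (reference_price l \<pi> t) (\<pi> ! t))
      = (\<Sum>t = length xs..<length \<pi>. g (reference_price l \<pi> t) (\<pi> ! t))"
    using len by (intro sum.atLeastLessThan_concat) auto
  then show ?case using block rest by (simp add: n_def)
qed

text \<open>Taking \<open>last \<rho>\<close> as the price before the first block makes every
  predecessor the cyclic one.\<close>

lemma up_one_down_power_string:
  assumes "finite P" and "distinct \<rho>" and "\<rho> \<noteq> []" and "set \<rho> \<subseteq> P"
  shows "up_one_down P l (power_string \<rho> (hold_times l (last \<rho>) \<rho>))"
proof -
  define k where "k = hold_times l (last \<rho>) \<rho>"
  have len: "length k = length \<rho>" by (simp add: k_def hold_times_def)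
  have k: "k ! t = hold_time l (cyclic_nth \<rho> (int t - 1)) (\<rho> ! t)" if "t < length \<rho>" for t
  proof -
    have "(last \<rho> # \<rho>) ! t = cyclic_nth \<rho> (int t - 1)"
    proof (cases t)
      case 0
      have "(- 1) mod int (length \<rho>) = int (length \<rho>) - 1"
        using \<open>\<rho> \<noteq> []\<close> by (simp add: zmod_minus1)
      moreover have "nat (int (length \<rho>) - 1) = length \<rho> - 1" by linarith
      ultimately show ?thesis
        using 0 \<open>\<rho> \<noteq> []\<close> by (simp add: cyclic_nth_def last_conv_nth)
    next
      case (Suc u)
      then show ?thesis using that by (simp add: cyclic_nth_of_nat)
    qed
    then show ?thesis using that by (simp add: k_def hold_times_def)
  qed
  have "length \<rho> \<le> card P"
    using assms card_mono distinct_card by metis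
  moreover have "length \<rho> = 1 \<longrightarrow> k ! 0 = 1"
    using k[of 0] \<open>\<rho> \<noteq> []\<close> by (auto simp: hold_time_def cyclic_nth_def)
  moreover have "same_cycle (power_string \<rho> k) (power_string \<rho> k)"
    by (simp add: same_cycle_def)
  ultimately show ?thesis
    unfolding up_one_down_def k_def[symmetric] using assms len k
    by (intro exI[of _ \<rho>] exI[of _ k]) (auto simp: hold_time_def)
qed

section \<open>Optimality of the best simple cycle\<close>

theorem theorem4p5:
  fixes P :: "real set" and l :: nat and g :: "real \<Rightarrow> real \<Rightarrow> real"
  assumes "finite P" and "P \<noteq> {}" and "l \<ge> 1" and "reference_monotone P g"
  shows "\<exists>\<pi>\<in>price_cycles P. up_one_down P l \<pi> \<and>
           (\<forall>\<sigma>\<in>price_cycles P. average_gain l g \<sigma> \<le> average_gain l g \<pi>)"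
proof -
  define w where "w = (\<lambda>r p. real (hold_time l r p))"
  define G where "G c = path_sum (\<lambda>r p. w r p * g r p) (c @ [hd c])" for c
  define T where "T c = path_sum w (c @ [hd c])" for c
  \<comment> \<open>Simple cycles are nonempty distinct lists over \<open>P\<close>; there are
    finitely many, so the best ratio is attained.\<close>
  define C where "C = {c. set c \<subseteq> P \<and> distinct c} - {[]}"
  have w1: "w r p \<ge> 1" for r p
    using \<open>l \<ge> 1\<close> by (simp add: w_def hold_time_def)
  have T_pos: "T c > 0" if "c \<noteq> []" for c
  proof -
    have "0 < real (length (tl c @ [hd c]))" by simp
    also have "\<dots> \<le> path_sum w (hd c # tl c @ [hd c])" by (intro length_le_path_sum w1)
    finally show ?thesis using that by (simp add: T_def flip: append_Cons)
  qed
  have "finite C" unfolding C_def using finite_subset_distinct[OF \<open>finite P\<close>] by simp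
  moreover have "C \<noteq> {}"
  proof -
    obtain p where "p \<in> P" using \<open>P \<noteq> {}\<close> by blast
    then have "[p] \<in> C" by (simp add: C_def)
    then show ?thesis by blast
  qed
  ultimately obtain c where c: "c \<in> C" and c_max: "\<And>c'. c' \<in> C \<Longrightarrow> G c' / T c' \<le> G c / T c"
    using obtains_MAX[of C "\<lambda>c. G c / T c"] Max_ge
    by (metis (no_types, lifting) finite_imageI imageI)
  define \<mu> where "\<mu> = G c / T c"
  define e where "e = (\<lambda>r p. w r p * (g r p - \<mu>))"

  \<comment> \<open>Multiplying by the positive duration turns maximality of \<open>\<mu>\<close>
    into nonpositive weight.\<close>
  have cyc: "path_sum e (c' @ [hd c']) \<le> 0" if "c' \<noteq> []" "distinct c'" "set c' \<subseteq> P" for c'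
  proof -
    have "G c' / T c' \<le> \<mu>" using c_max[of c'] that by (simp add: C_def \<mu>_def)
    then have "G c' - \<mu> * T c' \<le> 0" using T_pos[OF that(1)] by (simp add: divide_le_eq)
    then show ?thesis by (simp add: e_def G_def T_def path_sum_weighted_diff)
  qed
  obtain h where h: "\<And>r p. r \<in> P \<Longrightarrow> p \<in> P \<Longrightarrow> e r p + h p \<le> h r"
    and h_mono: "\<And>r r'. r \<in> P \<Longrightarrow> r' \<in> P \<Longrightarrow> (\<And>p. p \<in> P \<Longrightarrow> e r p \<le> e r' p) \<Longrightarrow> h r \<le> h r'"
    using no_positive_cycle_potential[OF \<open>finite P\<close> cyc] by blast
  have g_mono: "g r p \<le> g r' p" if "r \<in> P" "r' \<in> P" "p \<in> P" "r \<le> r'" for r r' p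
    using assms(4) that mono_onD[of P "\<lambda>r. g r p"] by (simp add: reference_monotone_def)
  have e_mono: "e r p \<le> e r' p" if "r \<in> P" "r' \<in> P" "p \<in> P" "r \<le> r'" for r r' p
  proof (cases "r < p \<and> p \<le> r'")
    case True
    \<comment> \<open>The only case in which the duration changes: there the self-loop at \<open>p\<close> forces \<open>g r p \<le> \<mu>\<close>.\<close>
    have "g p p \<le> \<mu>" using cyc[of "[p]"] that by (simp add: e_def w_def hold_time_def)
    then have "g r p - \<mu> \<le> 0" using g_mono[of r p p] that True by simp
    then have "real l * (g r p - \<mu>) \<le> 1 * (g r p - \<mu>)"
      using \<open>l \<ge> 1\<close> by (intro mult_right_mono_neg) auto
    also have "\<dots> \<le> g r' p - \<mu>" using g_mono that by simp
    finally show ?thesis using True by (simp add: e_def w_def hold_time_def)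
  next
    case False
    then have "w r p = w r' p" using that by (auto simp: w_def hold_time_def)
    then show ?thesis using g_mono that w1[of r' p] by (simp add: e_def mult_left_mono)
  qed
  \<comment> \<open>The edge inequality for \<open>h\<close>, read at duration 1 and at duration
    \<open>l\<close>, gives the conditions for the two price moves.\<close>
  have bound: "average_gain l g \<sigma> \<le> \<mu>" if "\<sigma> \<in> price_cycles P" for \<sigma>
  proof (rule average_gain_le[OF \<open>l \<ge> 1\<close>, where h = h])
    show "\<sigma> \<noteq> []" "set \<sigma> \<subseteq> P" using that by (simp_all add: price_cycles_def)
    show "mono_on P h" using h_mono e_mono by (intro mono_onI) blast
    show "g r p - \<mu> \<le> h r - h p" if "r \<in> P" "p \<in> P" "p \<le> r" for r p
      using h[of r p] that by (simp add: e_def w_def hold_time_def)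
    show "real l * (g r p - \<mu>) \<le> h r - h p" if "r \<in> P" "p \<in> P" "r < p" for r p
      using h[of r p] that by (simp add: e_def w_def hold_time_def)
  qed

  \<comment> \<open>Rotating the optimal cycle so that it ends in its cheapest price makes the window condition
    trivial at the start of the string.\<close>
  define m where "m = Min (set c)"
  have "m \<in> set c" using c by (auto simp: m_def C_def)
  then obtain a b where ab: "c = a @ m # b" by (meson split_list)
  define \<rho> where "\<rho> = b @ a @ [m]"
  have \<rho>: "set \<rho> = set c" "distinct \<rho>" "\<rho> \<noteq> []" "last \<rho> = m" "set \<rho> \<subseteq> P"
    using c by (auto simp: \<rho>_def ab C_def)
  \<comment> \<open>Stated for every weight \<open>u\<close>, as it serves both duration and
    gain.\<close>
  have closed: "path_sum u (m # \<rho>) = path_sum u (c @ [hd c])" for u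
    unfolding \<rho>_def ab by (rule path_sum_rotate)
  define \<pi> where "\<pi> = power_string \<rho> (hold_times l m \<rho>)"
  have len: "real (length \<pi>) = T c"
    unfolding \<pi>_def length_power_string_hold_times T_def w_def by (rule closed)
  then have "\<pi> \<noteq> []" using T_pos[of c] c by (auto simp: C_def)
  moreover have \<pi>_sub: "set \<pi> \<subseteq> set \<rho>" by (simp add: \<pi>_def set_power_string_subset)
  ultimately have \<pi>: "\<pi> \<in> price_cycles P" using \<rho> by (auto simp: price_cycles_def)
  have "path_sum (\<lambda>r p. real (hold_time l r p) * g r p) (m # \<rho>)
      \<le> (\<Sum>t = length ([] :: real list)..<length \<pi>. g (reference_price l \<pi> t) (\<pi> ! t))"
  proof (rule sum_gain_power_string_ge[OF assms(3,4)])
    show "\<pi> = [] @ power_string \<rho> (hold_times l m \<rho>)" by (simp add: \<pi>_def)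
    show "m \<in> P" using \<rho> \<open>m \<in> set c\<close> by blast
    show "m \<le> cyclic_nth \<pi> (int (length ([] :: real list)) - int j)" for j
    proof -
      have "cyclic_nth \<pi> (int (length ([] :: real list)) - int j) \<in> set c"
        using cyclic_nth_mem[OF \<open>\<pi> \<noteq> []\<close>] \<pi>_sub \<rho>(1) by blast
      then show ?thesis unfolding m_def by (intro Min_le) simp
    qed
    show "set \<pi> \<subseteq> P" using \<pi>_sub \<rho>(5) by blast
  qed (rule \<open>\<pi> \<noteq> []\<close> \<rho>(5))+
  then have "G c \<le> (\<Sum>t<length \<pi>. g (reference_price l \<pi> t) (\<pi> ! t))"
    by (simp only: closed G_def w_def atLeast0LessThan list.size)
  \<comment> \<open>A lower bound on the gain of \<open>\<pi>\<close> suffices, since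
    \<open>\<mu>\<close> bounds every price cycle from above.\<close>
  then have "\<mu> \<le> average_gain l g \<pi>"
    unfolding average_gain_def len \<mu>_def
    using T_pos[of c] c by (simp add: divide_right_mono C_def)
  moreover have "up_one_down P l \<pi>"
    using up_one_down_power_string[OF \<open>finite P\<close> \<rho>(2,3,5)] \<rho>(4) by (simp add: \<pi>_def)
  ultimately show ?thesis using \<pi> bound by (meson order_trans)
qed

end
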